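(* Let $n\ge2$, $c>0$, $p,q\in\mathbb{R}^n$ with $p\neq q$, and $\omega\in\mathbb{S}^{n-1}$. Let $$p'=p+a\,\omega,\qquad q'=q-a\,\omega,\qquad a=\frac{2(p^0+q^0)\{\omega\cdot(p^0q-q^0p)\}}{(p^0+q^0)^2-(\omega\cdot[p+q])^2}.$$ Then the angle $\theta$ defined by $$\cos\theta=\frac{(p^\mu-q^\mu)(p'_\mu-q'_\mu)}{\varrho^2}=\frac{-(p^0-q^0)(p'^0-q'^0)+(p-q)\cdot(p'-q')}{\varrho^2}$$ satisfies $$\cos\theta=1-\frac{8}{\varrho^2}\,\frac{\{\omega\cdot(p^0q-q^0p)\}^2}{(p^0+q^0)^2-(\omega\cdot[p+q])^2}.$$
   Context: For a momentum $p\in\mathbb{R}^n$ the energy is $p^0=\sqrt{c^2+|p|^2}$ and $p^\mu=(p^0,p)$; similarly for $q,p',q'$. Indices are lowered with the Minkowski metric $\mathrm{diag}(-1,1,\ldots,1)$ and repeated indices are summed. The relative momentum is $\varrho=\sqrt{(p^\mu-q^\mu)(p_\mu-q_\mu)}=\sqrt{2(p^0q^0-p\cdot q-c^2)}$. *)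

theory Defs
  imports "HOL-Analysis.Analysis"
begin

text \<open>The energy \<open>p\<^sup>0\<close> of a momentum \<open>p\<close>, for speed of light \<open>c\<close>.\<close>

definition energy :: "real \<Rightarrow> real ^ 'n::finite \<Rightarrow> real" where
  "energy c p = sqrt (c\<^sup>2 + (norm p)\<^sup>2)"

text \<open>A vector \<open>x\<^sup>\<mu>\<close> of Minkowski space is the pair of its time component \<open>x\<^sup>0\<close> and its
  spatial part.\<close>

type_synonym 'n four_vector = "real \<times> (real ^ 'n)"

definition four_momentum :: "real \<Rightarrow> real ^ 'n::finite \<Rightarrow> 'n four_vector" where
  "four_momentum c p = (energy c p, p)"

text \<open>Lowering the index with the metric \<open>diag(-1, 1, \<dots>, 1)\<close>.\<close>

definition lower :: "'n::finite four_vector \<Rightarrow> 'n four_vector" where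
  "lower x = (- fst x, snd x)"

text \<open>The contraction \<open>x\<^sup>\<mu> y\<^sub>\<mu>\<close>: the inner product on the right is the Euclidean one of
  the product type, i.e. the plain sum over all \<open>n + 1\<close> components.\<close>

definition mink :: "'n::finite four_vector \<Rightarrow> 'n four_vector \<Rightarrow> real" where
  "mink x y = x \<bullet> lower y"

definition rel_momentum :: "real \<Rightarrow> real ^ 'n::finite \<Rightarrow> real ^ 'n \<Rightarrow> real" where
  "rel_momentum c p q =
     sqrt (mink (four_momentum c p - four_momentum c q)
                (four_momentum c p - four_momentum c q))"

lemma rel_momentum_eq:
  fixes p q :: "real ^ 'n::finite"
  shows "rel_momentum c p q = sqrt (2 * (energy c p * energy c q - p \<bullet> q - c\<^sup>2))"
proof -
  have e: "energy c x * energy c x = c\<^sup>2 + x \<bullet> x" for x :: "real ^ 'n"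
    unfolding energy_def by (simp add: power2_norm_eq_inner)
  show ?thesis
    unfolding rel_momentum_def mink_def lower_def four_momentum_def
    by (simp add: algebra_simps inner_commute e)
qed

end

theory Submission
  imports Defs
begin

text \<open>
  Write \<open>P\<close>, \<open>Q\<close> for the four-momenta of \<open>p\<close>, \<open>q\<close> and \<open>S = P + Q\<close>. Put \<open>s = p\<^sup>0 + q\<^sup>0\<close> and let
  \<open>N = (\<omega> \<bullet> (p + q), s \<omega>)\<close>. This vector is orthogonal to \<open>S\<close> for the Minkowski form, and
  \<open>mink N N\<close> is exactly the denominator \<open>s\<^sup>2 - (\<omega> \<bullet> (p + q))\<^sup>2\<close>, while
  \<open>- mink P N = mink Q N = \<omega> \<bullet> (p\<^sup>0 q - q\<^sup>0 p)\<close>. The collision map is therefore the Lorentz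
  reflection in the hyperplane orthogonal to \<open>N\<close>: the spatial parts of the reflections of \<open>P\<close>
  and \<open>Q\<close> are \<open>p'\<close> and \<open>q'\<close>. That their time components are the energies of \<open>p'\<close> and \<open>q'\<close> is
  the one point that is not formal: a reflection preserves the mass shell, and, since it fixes
  the future timelike \<open>S\<close>, it cannot exchange the two sheets
  (\<open>four_momentum_reflect\<close>).

  The difference \<open>X = P - Q\<close> then goes to its own reflection, so that
  \<open>mink X X' = mink X X - 2 (mink X N)\<^sup>2 / mink N N\<close> with \<open>mink X N = - 2 \<omega> \<bullet> (p\<^sup>0 q - q\<^sup>0 p)\<close>,
  which is the formula for the cosine. The quotient really is a cosine because \<open>X\<close> and \<open>N\<close> both
  lie in the orthogonal complement of the timelike \<open>S\<close>, where the form is positive definite and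
  the Cauchy--Schwarz inequality \<open>(mink X N)\<^sup>2 \<le> mink X X * mink N N\<close> holds.
\<close>

section \<open>The Minkowski form\<close>

lemma mink_eq: "mink x y = - fst x * fst y + snd x \<bullet> snd y"
  by (simp add: mink_def lower_def inner_prod_def)

lemma mink_self: "mink x x = (norm (snd x))\<^sup>2 - (fst x)\<^sup>2"
  by (simp add: mink_eq power2_norm_eq_inner) (simp add: power2_eq_square)

lemma mink_commute: "mink x y = mink y x"
  by (simp add: mink_eq inner_commute)

lemma mink_simps:
  "mink (x + y) z = mink x z + mink y z" "mink z (x + y) = mink z x + mink z y"
  "mink (x - y) z = mink x z - mink y z" "mink z (x - y) = mink z x - mink z y"
  "mink (k *\<^sub>R x) z = k * mink x z" "mink z (k *\<^sub>R x) = k * mink z x"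
  by (simp_all add: mink_eq algebra_simps inner_add_left inner_add_right
      inner_diff_left inner_diff_right)

definition future_timelike :: "'n::finite four_vector \<Rightarrow> bool" where
  "future_timelike x \<longleftrightarrow> norm (snd x) < fst x"

lemma future_timelike_add:
  assumes "future_timelike x" "future_timelike y"
  shows "future_timelike (x + y)"
  using assms norm_triangle_ineq[of "snd x" "snd y"] by (simp add: future_timelike_def)

text \<open>Reversed Cauchy--Schwarz: the time components dominate the Euclidean inner product of the
  spatial parts.\<close>

lemma mink_future_neg:
  assumes "future_timelike x" "future_timelike y"
  shows "mink x y < 0"
proof -
  have "snd x \<bullet> snd y \<le> norm (snd x) * norm (snd y)"
    by (rule norm_cauchy_schwarz)
  also have "\<dots> < fst x * fst y"
    using assms by (intro mult_strict_mono') (auto simp: future_timelike_def)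
  finally show ?thesis by (simp add: mink_eq)
qed

text \<open>The sign of the product with one future timelike vector tells the two halves of the light
  cone apart.\<close>

lemma future_if_mink_neg:
  assumes S: "future_timelike S" and x: "mink x x < 0" and neg: "mink x S < 0"
  shows "fst x > 0"
proof (rule ccontr)
  assume "\<not> fst x > 0"
  then have nonpos: "fst x \<le> 0" by simp
  have "(norm (snd x))\<^sup>2 \<le> (- fst x)\<^sup>2"
    using x by (simp add: mink_self)
  then have le: "norm (snd x) \<le> - fst x"
    using nonpos power2_le_imp_le[of "norm (snd x)" "- fst x"] by simp
  have "- (snd x \<bullet> snd S) \<le> norm (snd x) * norm (snd S)"
    using Cauchy_Schwarz_ineq2[of "snd x" "snd S"] by linarith
  also have "\<dots> \<le> - fst x * fst S"
    using S le nonpos by (intro mult_mono) (auto simp: future_timelike_def)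
  finally show False using neg by (simp add: mink_eq)
qed

text \<open>Orthogonality determines the time component of \<open>x\<close> as \<open>snd x \<bullet> snd S / fst S\<close>, which the
  Euclidean Cauchy--Schwarz inequality bounds by less than \<open>norm (snd x)\<close>.\<close>

lemma mink_pos_on_orthogonal:
  assumes S: "future_timelike S" and orth: "mink x S = 0" and nz: "snd x \<noteq> 0"
  shows "mink x x > 0"
proof -
  have S0: "fst S > 0"
    using S norm_ge_zero[of "snd S"] unfolding future_timelike_def by linarith
  have "\<bar>fst x\<bar> * fst S = \<bar>snd x \<bullet> snd S\<bar>"
    using orth S0 by (simp add: mink_eq abs_mult)
  also have "\<dots> \<le> norm (snd x) * norm (snd S)"
    by (rule Cauchy_Schwarz_ineq2)
  also have "\<dots> < norm (snd x) * fst S"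
    using S nz by (simp add: future_timelike_def)
  finally have "\<bar>fst x\<bar> < \<bar>norm (snd x)\<bar>"
    using S0 by simp
  then have "(fst x)\<^sup>2 < (norm (snd x))\<^sup>2"
    by (rule power2_strict_mono)
  then show ?thesis
    by (simp add: mink_self)
qed

lemma mink_nonneg_on_orthogonal:
  assumes "future_timelike S" "mink x S = 0"
  shows "mink x x \<ge> 0"
proof (cases "snd x = 0")
  case True
  have "fst S \<noteq> 0"
    using assms(1) norm_ge_zero[of "snd S"] unfolding future_timelike_def by linarith
  then show ?thesis using assms(2) True by (simp add: mink_eq)
next
  case False
  then show ?thesis using mink_pos_on_orthogonal[OF assms] by simp
qed

text \<open>The usual argument, applied to the component of \<open>x\<close> orthogonal to \<open>y\<close>, which again
  lies in the orthogonal complement of \<open>S\<close>.\<close>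

lemma mink_Cauchy_Schwarz:
  assumes S: "future_timelike S" and x: "mink x S = 0" and y: "mink y S = 0"
    and pos: "mink y y > 0"
  shows "(mink x y)\<^sup>2 \<le> mink x x * mink y y"
proof -
  define z where "z = mink y y *\<^sub>R x - mink x y *\<^sub>R y"
  have "mink z S = 0"
    by (simp add: z_def mink_simps x y)
  then have "0 \<le> mink z z"
    by (rule mink_nonneg_on_orthogonal[OF S])
  also have "mink z z = mink y y * (mink x x * mink y y - (mink x y)\<^sup>2)"
    by (simp add: z_def mink_simps mink_commute[of y x] algebra_simps power2_eq_square)
  finally show ?thesis
    using pos by (simp add: zero_le_mult_iff)
qed

section \<open>Reflections and the mass shell\<close>

definition mink_reflect :: "'n::finite four_vector \<Rightarrow> 'n four_vector \<Rightarrow> 'n four_vector" where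
  "mink_reflect N x = x - (2 * mink x N / mink N N) *\<^sub>R N"

lemma mink_reflect_diff:
  "mink_reflect N (x - y) = mink_reflect N x - mink_reflect N y"
  by (simp add: mink_reflect_def mink_simps diff_divide_distrib algebra_simps)

lemma mink_reflect_right:
  "mink x (mink_reflect N x) = mink x x - 2 * (mink x N)\<^sup>2 / mink N N"
  by (simp add: mink_reflect_def mink_simps power2_eq_square)

lemma mink_reflect_isometry:
  assumes "mink N N \<noteq> 0"
  shows "mink (mink_reflect N x) (mink_reflect N y) = mink x y"
  using assms
  by (simp add: mink_reflect_def mink_simps mink_commute[of N y] field_simps)

lemma energy_sq: "(energy c p)\<^sup>2 = c\<^sup>2 + (norm p)\<^sup>2"
  by (simp add: energy_def)

lemma future_timelike_four_momentum:
  assumes "c > 0"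
  shows "future_timelike (four_momentum c p)"
  using assms by (simp add: future_timelike_def four_momentum_def energy_def real_less_rsqrt)

lemma mink_four_momentum_self: "mink (four_momentum c p) (four_momentum c p) = - c\<^sup>2"
  by (simp add: mink_self four_momentum_def energy_sq)

lemma four_momentum_eqI:
  assumes "mink x x = - c\<^sup>2" and "fst x > 0"
  shows "four_momentum c (snd x) = x"
proof -
  have "c\<^sup>2 + (norm (snd x))\<^sup>2 = (fst x)\<^sup>2"
    using assms(1) by (simp add: mink_self)
  then show ?thesis
    using assms(2) by (simp add: four_momentum_def energy_def prod_eq_iff)
qed

text \<open>Being an isometry that fixes \<open>S\<close>, the reflection preserves the sign of the product with
  \<open>S\<close>; hence it maps the future sheet of the mass shell to itself.\<close>

lemma four_momentum_reflect:
  assumes c: "c > 0" and S: "future_timelike S" and orth: "mink N S = 0" and N: "mink N N \<noteq> 0"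
  shows "four_momentum c (snd (mink_reflect N (four_momentum c p)))
    = mink_reflect N (four_momentum c p)"
proof (rule four_momentum_eqI)
  let ?x = "mink_reflect N (four_momentum c p)"
  show shell: "mink ?x ?x = - c\<^sup>2"
    by (simp add: mink_reflect_isometry[OF N] mink_four_momentum_self)
  have "mink ?x S = mink (four_momentum c p) S"
    by (simp add: mink_reflect_def mink_simps orth)
  also have "\<dots> < 0"
    using mink_future_neg[OF future_timelike_four_momentum[OF c] S] .
  finally show "fst ?x > 0"
    using shell c by (intro future_if_mink_neg[OF S]) auto
qed

section \<open>The scattering angle\<close>

theorem mainTheorem6:
  fixes p q p' q' \<omega> :: "real ^ 'n::finite" and a c :: real
  assumes "CARD('n) \<ge> 2" and "c > 0" and "p \<noteq> q" and "\<omega> \<in> sphere 0 1"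
    and "a = 2 * (energy c p + energy c q) * (\<omega> \<bullet> (energy c p *\<^sub>R q - energy c q *\<^sub>R p))
             / ((energy c p + energy c q)\<^sup>2 - (\<omega> \<bullet> (p + q))\<^sup>2)"
    and "p' = p + a *\<^sub>R \<omega>" and "q' = q - a *\<^sub>R \<omega>"
  shows
    "(\<exists>!\<theta>. 0 \<le> \<theta> \<and> \<theta> \<le> pi \<and>
        cos \<theta> = mink (four_momentum c p - four_momentum c q)
                     (four_momentum c p' - four_momentum c q') / (rel_momentum c p q)\<^sup>2) \<and>
     mink (four_momentum c p - four_momentum c q)
          (four_momentum c p' - four_momentum c q') / (rel_momentum c p q)\<^sup>2
       = (- (energy c p - energy c q) * (energy c p' - energy c q') + (p - q) \<bullet> (p' - q'))
           / (rel_momentum c p q)\<^sup>2 \<and>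
     (\<forall>\<theta>. cos \<theta> = mink (four_momentum c p - four_momentum c q)
                     (four_momentum c p' - four_momentum c q') / (rel_momentum c p q)\<^sup>2 \<longrightarrow>
        cos \<theta> = 1 - 8 / (rel_momentum c p q)\<^sup>2 *
          ((\<omega> \<bullet> (energy c p *\<^sub>R q - energy c q *\<^sub>R p))\<^sup>2
            / ((energy c p + energy c q)\<^sup>2 - (\<omega> \<bullet> (p + q))\<^sup>2)))"
proof -
  define P Q where "P = four_momentum c p" and "Q = four_momentum c q"
  define S X where "S = P + Q" and "X = P - Q"
  define s where "s = energy c p + energy c q"
  define N :: "'n four_vector" where "N = (\<omega> \<bullet> (p + q), s *\<^sub>R \<omega>)"
  define w where "w = \<omega> \<bullet> (energy c p *\<^sub>R q - energy c q *\<^sub>R p)"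
  define D where "D = s\<^sup>2 - (\<omega> \<bullet> (p + q))\<^sup>2"
  have omega: "norm \<omega> = 1" using assms(4) by simp
  have S: "future_timelike S"
    unfolding S_def P_def Q_def
    by (intro future_timelike_add future_timelike_four_momentum assms(2))
  have S_eq: "S = (s, p + q)"
    by (simp add: S_def P_def Q_def s_def four_momentum_def)
  have "s > 0"
    using S norm_ge_zero[of "p + q"] unfolding future_timelike_def S_eq fst_conv snd_conv
    by linarith

  have NS: "mink N S = 0"
    by (simp add: mink_eq N_def S_eq)
  have NN: "mink N N = D"
    using omega by (simp add: mink_eq N_def D_def power2_eq_square flip: norm_eq_1)
  have "D > 0"
    unfolding NN[symmetric] using \<open>s > 0\<close> omega
    by (intro mink_pos_on_orthogonal[OF S NS]) (auto simp: N_def)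
  have PN: "mink P N = - w" and QN: "mink Q N = w"
    by (simp_all add: mink_eq P_def Q_def four_momentum_def N_def s_def w_def
        algebra_simps inner_add_right inner_diff_right inner_commute)

  have a: "a = 2 * s * w / D"
    using assms(5) by (simp add: s_def w_def D_def)
  have p': "p' = snd (mink_reflect N P)" and q': "q' = snd (mink_reflect N Q)"
    unfolding mink_reflect_def PN QN NN assms(6,7) a
    by (simp_all add: N_def P_def Q_def four_momentum_def ac_simps)
  have P': "four_momentum c p' = mink_reflect N P" and Q': "four_momentum c q' = mink_reflect N Q"
    unfolding p' q' P_def Q_def using \<open>D > 0\<close> NN
    by (auto intro!: four_momentum_reflect[OF assms(2) S NS])

  \<comment> \<open>\<open>P\<close> and \<open>Q\<close> lie on the same mass shell.\<close>
  have XS: "mink X S = 0"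
    using mink_commute[of P Q]
    by (simp add: X_def S_def mink_simps) (simp add: P_def Q_def mink_four_momentum_self)
  have "mink X X > 0"
    using assms(3)
    by (intro mink_pos_on_orthogonal[OF S XS]) (simp add: X_def P_def Q_def four_momentum_def)
  then have rho: "(rel_momentum c p q)\<^sup>2 = mink X X"
    by (simp add: rel_momentum_def X_def P_def Q_def)
  have XN: "mink X N = - 2 * w"
    by (simp add: X_def mink_simps PN QN)
  have num: "mink X (four_momentum c p' - four_momentum c q') = mink X X - 8 * w\<^sup>2 / D"
    unfolding P' Q' mink_reflect_diff[symmetric] X_def[symmetric]
    by (simp add: mink_reflect_right XN NN power_mult_distrib)
  define C where "C = mink X (four_momentum c p' - four_momentum c q') / (rel_momentum c p q)\<^sup>2"
  have C: "C = 1 - 8 / (rel_momentum c p q)\<^sup>2 * (w\<^sup>2 / D)"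
    using \<open>mink X X > 0\<close> by (simp add: C_def num rho diff_divide_distrib)

  have "4 * w\<^sup>2 \<le> mink X X * D"
    using mink_Cauchy_Schwarz[OF S XS NS] \<open>D > 0\<close> by (simp add: NN XN power_mult_distrib)
  then have "8 / mink X X * (w\<^sup>2 / D) \<le> 2"
    using \<open>mink X X > 0\<close> \<open>D > 0\<close> by (simp add: field_simps)
  moreover have "0 \<le> 8 / mink X X * (w\<^sup>2 / D)"
    using \<open>mink X X > 0\<close> \<open>D > 0\<close> by simp
  ultimately have range: "- 1 \<le> C" "C \<le> 1"
    unfolding C rho by linarith+
  have "\<exists>!\<theta>. 0 \<le> \<theta> \<and> \<theta> \<le> pi \<and> cos \<theta> = C"
    by (rule ex1I[of _ "arccos C"]) (use range in \<open>auto simp: arccos_lbound arccos_ubound arccos_cos\<close>)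
  moreover have "C = (- (energy c p - energy c q) * (energy c p' - energy c q')
      + (p - q) \<bullet> (p' - q')) / (rel_momentum c p q)\<^sup>2"
    by (simp add: C_def X_def P_def Q_def mink_eq four_momentum_def)
  ultimately show ?thesis
    using C unfolding C_def X_def P_def Q_def w_def D_def s_def
    by (intro conjI allI impI) (assumption | erule trans)+
qed

end
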